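(* Let $\ell\ge2$ be an integer and let $g(x)=\sum_{s=0}^{\ell}b_sx^s$ with $b_0,\dots,b_\ell\in\mathbb{R}$. Let $\Sigma$ be a finite alphabet and let $c\colon[0,1)\to\Sigma$ be a non-constant piecewise-constant function with partition boundaries $0=\gamma_0<\gamma_1<\cdots<\gamma_d=1$. Let $\mathbf{a}=a_0a_1a_2\cdots$ be defined by $a_n=c(\{g(n)\})$ for $n\ge0$. Assume that there exist a sequence of positive integers $q_n\to\infty$ and a sequence of real numbers $N_n$ such that (1) $0<\max_{1\le s\le\ell}\|q_nb_s\|\le q_n^{-N_n}$ for all $n$, and (2) $\lim_{n\to\infty} \dfrac{N_n\ln(q_n)}{q_n}=\infty$. Then $\mathbf{Dio}(\mathbf{a})=\infty$.
   Context: $\{\cdot\}$ denotes the fractional part, $\|y\|$ denotes the distance from a real number $y$ to its nearest integer, and $\ln$ is the natural logarithm. That $c$ is piecewise constant with partition boundaries $0=\gamma_0<\cdots<\gamma_d=1$ means that $c$ is constant on each interval $[\gamma_{j-1},\gamma_j)$, $1\le j\le d$. For integers $0\le r\le s$, $\mathbf{a}[r,s]$ denotes the finite word $a_ra_{r+1}\cdots a_s$. Diophantine exponent: $\mathbf{Dio}(\mathbf{a})\in[1,\infty]$ is the supremum of the real numbers $\rho$ for which there exist three sequences of integers $(r_n)_{n\ge0}$, $(s_n)_{n\ge0}$, $(t_n)_{n\ge0}$ such that, for all $n\ge 0$, $-1\le r_n<s_n<t_n$, the words $\mathbf{a}[r_n+1,r_n+t_n-s_n]$ and $\mathbf{a}[s_n+1,t_n]$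 coincide, $t_n\ge\rho s_n$, and moreover $s_n-r_n\to\infty$ as $n\to\infty$. *)

theory Defs
  imports "HOL-Analysis.Analysis"
begin

abbreviation dist_nearest_int :: "real \<Rightarrow> real" where
  "dist_nearest_int y \<equiv> infdist y \<int>"

text \<open>The letters are indexed by naturals, but the positions below are integers (the sequence
  \<open>r\<close> in the Diophantine exponent may take the value \<open>-1\<close>); \<open>subword\<close> is only used for
  \<open>0 \<le> i \<le> j\<close>.\<close>

definition subword :: "(nat \<Rightarrow> 'a) \<Rightarrow> int \<Rightarrow> int \<Rightarrow> 'a list" where
  "subword a i j = map (\<lambda>k. a (nat k)) [i..j]"

definition Dio_admissible :: "(nat \<Rightarrow> 'a) \<Rightarrow> real \<Rightarrow> bool" where
  "Dio_admissible a \<rho> \<longleftrightarrow>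
     (\<exists>r s t :: nat \<Rightarrow> int.
        (\<forall>n. - 1 \<le> r n \<and> r n < s n \<and> s n < t n \<and>
             subword a (r n + 1) (r n + t n - s n) = subword a (s n + 1) (t n) \<and>
             real_of_int (t n) \<ge> \<rho> * real_of_int (s n)) \<and>
        filterlim (\<lambda>n. s n - r n) at_top sequentially)"

definition Dio :: "(nat \<Rightarrow> 'a) \<Rightarrow> ereal" where
  "Dio a = Sup (ereal ` {\<rho>. Dio_admissible a \<rho>})"

definition piecewise_constant :: "(real \<Rightarrow> 'a) \<Rightarrow> (nat \<Rightarrow> real) \<Rightarrow> nat \<Rightarrow> bool" where
  "piecewise_constant c \<gamma> d \<longleftrightarrow>
     \<gamma> 0 = 0 \<and> \<gamma> d = 1 \<and> strict_mono_on {0..d} \<gamma> \<and>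
     (\<forall>j\<in>{1..d}. c constant_on {\<gamma> (j - 1)..<\<gamma> j})"

end

theory Submission
  imports Defs
begin

text \<open>Write \<open>q b\<^sub>s = p\<^sub>s + e\<^sub>s\<close> with \<open>p\<^sub>s\<close> the nearest integer. Modulo \<open>1\<close>, \<open>g(n) = u(n) + D(n)\<close>, where
  \<open>u(n)\<close> depends only on \<open>n mod q\<close> and \<open>D\<close> is a polynomial with the tiny coefficients \<open>e\<^sub>s / q\<close>. As long
  as \<open>\<bar>D\<bar> \<le> 1\<close>, the letter \<open>a\<^sub>n\<close> is determined by the comparison of \<open>D(n)\<close> with the \<open>O(q)\<close> numbers
  \<open>\<gamma>\<^sub>j + k - u(n)\<close>, \<open>\<bar>k\<bar> \<le> 1\<close>, and these comparisons change at \<open>O(q)\<close> places only, the implied constant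
  depending on \<open>d\<close> and \<open>l\<close>. Among \<open>O(q)\<close> consecutive
  intervals \<open>[q R\<^sup>i, q R\<^sup>i\<^sup>+\<^sup>1)\<close> one therefore contains no change, and on it \<open>\<^bold>a\<close> has period \<open>q\<close>. The growth
  of \<open>N\<^sub>n ln q\<^sub>n / q\<^sub>n\<close> is what makes \<open>\<bar>D\<bar> \<le> 1\<close> up to \<open>R\<^bsup>O(q)\<^esup>\<close>, for any fixed ratio \<open>R\<close>.\<close>

section \<open>Letters as threshold comparisons\<close>

text \<open>The translates by -1, 0, 1 of the boundaries cut [-1, 2) into translated pieces of
  \<open>c\<close>, so the comparisons locate \<open>x\<close> in one of them and force
  \<open>y\<close> into the same one.\<close>

lemma piecewise_constant_frac_eq:
  assumes pc: "piecewise_constant c \<gamma> d"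
    and x: "- 1 \<le> x" "x < 2"
    and cmp: "\<And>j k. j \<le> d \<Longrightarrow> k \<in> {- 1, 0, 1::int} \<Longrightarrow> \<gamma> j + of_int k \<le> x \<longleftrightarrow> \<gamma> j + of_int k \<le> y"
  shows "c (frac x) = c (frac y)"
proof -
  define k where "k = \<lfloor>x\<rfloor>"
  have k: "k \<in> {- 1, 0, 1}"
    using x unfolding k_def by (simp; linarith)
  have \<gamma>: "\<gamma> 0 = 0" "\<gamma> d = 1" "\<And>j. j \<in> {1..d} \<Longrightarrow> c constant_on {\<gamma> (j - 1)..<\<gamma> j}"
    using pc by (auto simp: piecewise_constant_def)
  have kx: "of_int k \<le> x" "x < of_int k + 1"
    unfolding k_def by linarith+
  \<comment> \<open>As \<gamma> 0 = 0 and \<gamma> d = 1, the integers \<open>k\<close> and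
    \<open>k + 1\<close> are themselves thresholds; this confines \<open>y\<close> without a range
    assumption on it.\<close>
  have "of_int k \<le> y" "y < of_int k + 1"
    using cmp[of 0 k] cmp[of d k] k kx \<gamma> by auto
  then have "\<lfloor>y\<rfloor> = k"
    by linarith
  then have fr: "frac x = x - of_int k" "frac y = y - of_int k"
    by (simp_all add: frac_def k_def)
  define j where "j = (LEAST j. frac x < \<gamma> j)"
  have ex: "frac x < \<gamma> d"
    by (simp add: \<gamma> frac_lt_1)
  then have j: "frac x < \<gamma> j" "j \<le> d"
    unfolding j_def by (auto intro: LeastI Least_le)
  have "j \<noteq> 0"
    using j(1) frac_ge_0[of x] \<gamma>(1) by (metis not_less)
  then have j1: "j \<in> {1..d}" "\<gamma> (j - 1) \<le> frac x"
    using j not_less_Least[of "j - 1" "\<lambda>j. frac x < \<gamma> j"] by (auto simp: j_def[symmetric])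
  have "frac x \<in> {\<gamma> (j - 1)..<\<gamma> j}" "frac y \<in> {\<gamma> (j - 1)..<\<gamma> j}"
    using j j1 cmp[of j k] cmp[of "j - 1" k] k by (auto simp: fr algebra_simps)
  with \<gamma>(3)[OF j1(1)] show ?thesis
    by (auto simp: constant_on_def)
qed

section \<open>Few changes of comparison for a polynomial\<close>

text \<open>Intermediate value theorem: the image of the interval is connected, so values on both
  sides of \<open>w\<close> would force the value \<open>w\<close>.\<close>

lemma poly_ge_iff_of_no_root:
  fixes p :: "real poly"
  assumes "x \<in> {a..<b}" "y \<in> {a..<b}"
    and nr: "\<And>z. z \<in> {a..<b} \<Longrightarrow> poly p z \<noteq> w"
  shows "w \<le> poly p x \<longleftrightarrow> w \<le> poly p y"
proof -
  have *: "w \<le> poly p v" if "w \<le> poly p u" "u \<in> {a..<b}" "v \<in> {a..<b}" for u v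
  proof (rule ccontr)
    assume "\<not> w \<le> poly p v"
    then have "w \<in> closed_segment (poly p u) (poly p v)"
      using that by (auto simp: closed_segment_eq_real_ivl)
    moreover have "connected (poly p ` {a..<b})"
      by (intro connected_continuous_image continuous_intros) auto
    then have "closed_segment (poly p u) (poly p v) \<subseteq> poly p ` {a..<b}"
      using that by (intro closed_segment_subset) (auto simp flip: is_interval_convex_1 simp: is_interval_connected_1)
    ultimately have "w \<in> poly p ` {a..<b}"
      by blast
    then show False
      using nr by blast
  qed
  show ?thesis
    using *[of x y] *[of y x] assms(1,2) by blast
qed

text \<open>Pigeonhole: \<open>M + 1\<close> disjoint intervals cannot all be met by at most
  \<open>M\<close> points.\<close>

lemma finite_set_misses_geometric_interval:
  fixes Z :: "real set" and A R :: real
  assumes "finite Z" "card Z \<le> M" "A \<ge> 0" "R \<ge> 1"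
  shows "\<exists>i\<le>M. Z \<inter> {A * R ^ i..<A * R ^ Suc i} = {}"
proof (rule ccontr)
  assume "\<not> ?thesis"
  then have "\<forall>i\<in>{..M}. \<exists>z. z \<in> Z \<and> A * R ^ i \<le> z \<and> z < A * R ^ Suc i"
    by fastforce
  then obtain z where z: "\<And>i. i \<le> M \<Longrightarrow> z i \<in> Z \<and> A * R ^ i \<le> z i \<and> z i < A * R ^ Suc i"
    by (metis atMost_iff)
  have lt: "z i < z j" if "i < j" "j \<le> M" for i j
  proof -
    have "z i < A * R ^ Suc i"
      using z[of i] that by simp
    also have "\<dots> \<le> A * R ^ j"
      using that assms by (intro mult_left_mono power_increasing) auto
    also have "\<dots> \<le> z j"
      using z[of j] that by simp
    finally show ?thesis .
  qed
  have "inj_on z {..M}"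
    by (intro linorder_inj_onI) (use lt in \<open>force\<close>)+
  moreover have "z ` {..M} \<subseteq> Z"
    using z by auto
  ultimately have "card {..M} \<le> card Z"
    using assms(1) by (metis card_inj_on_le)
  with assms(2) show False
    by simp
qed

text \<open>Each \<open>w\<close> contributes at most \<open>l\<close> points where \<open>D\<close>
  takes the value \<open>w\<close>, so at most \<open>M\<close> in total, and some interval avoids
  them all.\<close>

lemma poly_comparisons_constant_on_geometric_interval:
  fixes D :: "real poly" and A R :: real
  assumes W: "finite W" "card W * l \<le> M" and deg: "degree D \<le> l" and AR: "A \<ge> 0" "R \<ge> 1"
  shows "\<exists>i\<le>M. \<forall>w\<in>W. \<forall>x\<in>{A * R ^ i..<A * R ^ Suc i}. \<forall>y\<in>{A * R ^ i..<A * R ^ Suc i}.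
           w \<le> poly D x \<longleftrightarrow> w \<le> poly D y"
proof -
  \<comment> \<open>If \<open>D\<close> is the constant \<open>w\<close>, it takes this value
    everywhere, but the comparison never changes; the empty set keeps the count finite.\<close>
  define roots where "roots w = (if D = [:w:] then {} else {x. poly D x = w})" for w
  have roots: "finite (roots w) \<and> card (roots w) \<le> l" for w
  proof (cases "D = [:w:]")
    case False
    have "{x. poly D x = w} = {x. poly (D - [:w:]) x = 0}"
      by auto
    moreover have "degree (D - [:w:]) \<le> l"
      using deg by (intro degree_diff_le) auto
    ultimately show ?thesis
      using False poly_roots_finite[of "D - [:w:]"] card_poly_roots_bound[of "D - [:w:]"]
      by (auto simp: roots_def)
  qed (simp add: roots_def)
  have "card (\<Union>w\<in>W. roots w) \<le> (\<Sum>w\<in>W. card (roots w))"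
    using W by (rule_tac card_UN_le)
  also have "\<dots> \<le> card W * l"
    using sum_bounded_above[of W "\<lambda>w. card (roots w)" l] roots by simp
  finally have "card (\<Union>w\<in>W. roots w) \<le> M"
    using W by simp
  moreover have "finite (\<Union>w\<in>W. roots w)"
    using W roots by blast
  ultimately obtain i where i: "i \<le> M" "(\<Union>w\<in>W. roots w) \<inter> {A * R ^ i..<A * R ^ Suc i} = {}"
    using finite_set_misses_geometric_interval[OF _ _ AR] by blast
  show ?thesis
  proof (intro exI[of _ i] conjI ballI)
    fix w x y
    assume w: "w \<in> W" and xy: "x \<in> {A * R ^ i..<A * R ^ Suc i}" "y \<in> {A * R ^ i..<A * R ^ Suc i}"
    show "w \<le> poly D x \<longleftrightarrow> w \<le> poly D y"
    proof (cases "D = [:w:]")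
      case False
      then have "roots w = {x. poly D x = w}"
        by (simp add: roots_def)
      then show ?thesis
        using i(2) w by (intro poly_ge_iff_of_no_root[OF xy]) blast
    qed simp
  qed (use i in simp)
qed

section \<open>A long stretch of period q\<close>

text \<open>\<open>M\<close> bounds the number of changes: \<open>q\<close> residues,
  \<open>3 * Suc d\<close> translated boundaries, \<open>l\<close> roots for each. The hypothesis
  \<open>small\<close> keeps the perturbation at most 1 in absolute value up to the end of the last
  candidate interval.\<close>

lemma periodic_stretch:
  fixes b \<gamma> e :: "nat \<Rightarrow> real" and p :: "nat \<Rightarrow> int" and c :: "real \<Rightarrow> 'a" and q R :: nat
  assumes g: "\<And>x. g x = (\<Sum>s=0..l. b s * x ^ s)"
    and pc: "piecewise_constant c \<gamma> d"
    and a: "\<And>n. a n = c (frac (g (real n)))"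
    and q: "q > 0" and R: "R \<ge> 1"
    and e: "\<And>s. s \<in> {1..l} \<Longrightarrow> real q * b s = of_int (p s) + e s"
    and bound: "\<And>s. s \<in> {1..l} \<Longrightarrow> \<bar>e s\<bar> \<le> \<eta>"
    and M: "q * (3 * Suc d) * l \<le> M"
    and small: "real l * \<eta> * real (q * R ^ Suc M) ^ l \<le> 1"
  shows "\<exists>i. \<forall>n. q * R ^ i \<le> n \<longrightarrow> n + q < q * R ^ Suc i \<longrightarrow> a (n + q) = a n"
proof -
  \<comment> \<open>The sum starts at 1: the coefficient \<open>b 0\<close> needs no rational
    approximation and goes unchanged into \<open>u\<close>.\<close>
  define P where "P n = (\<Sum>s=1..l. p s * int n ^ s)" for n
  define u where "u n = frac (b 0 + of_int (P n) / real q)" for n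
  define D where "D = (\<Sum>s=1..l. monom (e s / real q) s)"
  have D: "poly D x = (\<Sum>s=1..l. e s / real q * x ^ s)" for x
    by (simp add: D_def poly_sum poly_monom)
  have deg: "degree D \<le> l"
    unfolding D_def by (intro degree_sum_le) (auto intro: degree_monom_le[THEN order_trans])
  have gu: "frac (g (real n)) = frac (u n + poly D (real n))" for n
  proof -
    have bs: "b s = of_int (p s) / real q + e s / real q" if "s \<in> {1..l}" for s
      using e[OF that] q by (simp add: field_simps)
    have "g (real n) = b 0 + (\<Sum>s=1..l. b s * real n ^ s)"
      unfolding g by (simp add: sum.atLeast_Suc_atMost)
    also have "(\<Sum>s=1..l. b s * real n ^ s) = of_int (P n) / real q + poly D (real n)"
      unfolding D P_def of_int_sum sum_divide_distrib sum.distrib[symmetric]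
      by (intro sum.cong refl) (simp add: bs algebra_simps)
    finally have "g (real n) = (u n + poly D (real n)) + of_int \<lfloor>b 0 + of_int (P n) / real q\<rfloor>"
      by (simp add: u_def frac_def)
    then show ?thesis
      by simp
  qed
  have u_per: "u (n + q) = u n" for n
  proof -
    \<comment> \<open>Integer polynomials respect congruence mod \<open>q\<close>, so
      \<open>P n / q\<close> has period \<open>q\<close> modulo 1.\<close>
    have "int q dvd (\<Sum>s=1..l. p s * (int (n + q) ^ s - int n ^ s))"
    proof (intro dvd_sum dvd_mult)
      fix s
      have "int (n + q) - int n dvd int (n + q) ^ s - int n ^ s"
        by (metis dvd_triv_left power_diff_sumr2)
      then show "int q dvd int (n + q) ^ s - int n ^ s"
        by simp
    qed
    then have "int q dvd P (n + q) - P n"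
      unfolding P_def by (simp add: sum_subtractf right_diff_distrib)
    then obtain k where "P (n + q) = P n + int q * k"
      by (metis dvd_def diff_add_cancel add.commute)
    then have "b 0 + of_int (P (n + q)) / real q = (b 0 + of_int (P n) / real q) + of_int k"
      using q by (simp add: field_simps)
    then show ?thesis
      unfolding u_def by (simp only: frac_add_of_int_right)
  qed
  have u_mod: "u n = u (n mod q)" for n
  proof (induction n rule: less_induct)
    case (less n)
    then show ?case
      using less[of "n - q"] u_per[of "n - q"] q by (cases "n < q") (auto simp: le_mod_geq)
  qed
  have u01: "0 \<le> u n" "u n < 1" for n
    by (simp_all add: u_def frac_lt_1)
  \<comment> \<open>Only residues \<open>m < q\<close> are listed, which makes \<open>W\<close>
    finite; by \<open>u_mod\<close> it still contains the thresholds of every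
    \<open>n\<close>.\<close>
  define W where "W = (\<lambda>(m, j, k). \<gamma> j + of_int k - u m) ` ({..<q} \<times> {..d} \<times> {- 1, 0, 1::int})"
  have W: "finite W" "card W * l \<le> M"
  proof -
    have "card W \<le> card ({..<q} \<times> {..d} \<times> {- 1, 0, 1::int})"
      unfolding W_def by (intro card_image_le) auto
    also have "\<dots> = q * (3 * Suc d)"
      by (simp add: card_cartesian_product algebra_simps)
    finally show "card W * l \<le> M"
      using M by (meson mult_le_mono1 order_trans)
  qed (simp add: W_def)
  have WI: "\<gamma> j + of_int k - u n \<in> W" if "j \<le> d" "k \<in> {- 1, 0, 1::int}" for n j k
  proof -
    have "(n mod q, j, k) \<in> {..<q} \<times> {..d} \<times> {- 1, 0, 1}"
      using that q by simp
    from imageI[OF this, of "\<lambda>(m, j, k). \<gamma> j + of_int k - u m"] show ?thesis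
      unfolding W_def prod.case u_mod[of n, symmetric] .
  qed
  obtain i where i: "i \<le> M" and cmp: "\<And>w x y. w \<in> W \<Longrightarrow> x \<in> {real q * real R ^ i..<real q * real R ^ Suc i} \<Longrightarrow>
      y \<in> {real q * real R ^ i..<real q * real R ^ Suc i} \<Longrightarrow> w \<le> poly D x \<longleftrightarrow> w \<le> poly D y"
  proof -
    have "real q \<ge> 0" "real R \<ge> 1"
      using R by auto
    from poly_comparisons_constant_on_geometric_interval[OF W deg this] show ?thesis
      using that by blast
  qed
  have D1: "\<bar>poly D x\<bar> \<le> 1" if x: "1 \<le> x" "x \<le> real (q * R ^ Suc M)" for x
  proof -
    have "\<bar>poly D x\<bar> \<le> (\<Sum>s=1..l. \<bar>e s / real q * x ^ s\<bar>)"
      unfolding D by (rule sum_abs)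
    also have "\<dots> \<le> (\<Sum>s=1..l. \<eta> * real (q * R ^ Suc M) ^ l)"
    proof (intro sum_mono)
      fix s assume s: "s \<in> {1..l}"
      have "\<bar>e s / real q * x ^ s\<bar> = \<bar>e s\<bar> / real q * x ^ s"
        using x by (simp add: abs_mult)
      also have "\<bar>e s\<bar> / real q \<le> \<bar>e s\<bar>"
        using q by (simp add: divide_le_eq mult_le_cancel_left1)
      then have "\<bar>e s\<bar> / real q * x ^ s \<le> \<eta> * x ^ l"
        using s x bound[OF s] by (intro mult_mono power_increasing) auto
      also have "\<dots> \<le> \<eta> * real (q * R ^ Suc M) ^ l"
        using x bound[OF s] by (intro mult_left_mono power_mono) auto
      finally show "\<bar>e s / real q * x ^ s\<bar> \<le> \<eta> * real (q * R ^ Suc M) ^ l" .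
    qed
    also have "\<dots> \<le> 1"
      using small by simp
    finally show ?thesis .
  qed
  show ?thesis
  proof (intro exI[of _ i] allI impI)
    fix n assume n: "q * R ^ i \<le> n" "n + q < q * R ^ Suc i"
    have "real (q * R ^ i) \<le> real n" "real (n + q) < real (q * R ^ Suc i)"
      using n by (simp_all only: of_nat_le_iff of_nat_less_iff)
    then have I: "real n \<in> {real q * real R ^ i..<real q * real R ^ Suc i}"
        "real (n + q) \<in> {real q * real R ^ i..<real q * real R ^ Suc i}"
      by auto
    have "q * R ^ Suc i \<le> q * R ^ Suc M"
      using i R by (intro mult_le_mono power_increasing) auto
    with n have "n \<le> q * R ^ Suc M"
      by linarith
    moreover have "q * R ^ i > 0"
      using q R by simp
    with n have "n \<ge> 1"
      by linarith
    ultimately have "\<bar>poly D (real n)\<bar> \<le> 1"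
      by (intro D1) (simp_all only: of_nat_le_iff real_of_nat_ge_one_iff)
    \<comment> \<open>Both arguments carry the same \<open>u n\<close>, so only the values of
      \<open>D\<close> are compared; the bound 1 on \<open>D\<close> puts the first argument in [-1,
      2).\<close>
    then have "c (frac (u n + poly D (real n))) = c (frac (u n + poly D (real (n + q))))"
      using u01[of n] cmp[OF WI I]
      by (intro piecewise_constant_frac_eq[OF pc]) (auto simp: algebra_simps)
    then show "a (n + q) = a n"
      by (simp only: a gu u_per)
  qed
qed

section \<open>From periodic stretches to the Diophantine exponent\<close>

lemma subword_eqI:
  assumes "j - i = j' - i'" "\<And>k. i \<le> k \<Longrightarrow> k \<le> j \<Longrightarrow> a (nat k) = a (nat (k + (i' - i)))"
  shows "subword a i j = subword a i' j'"
proof (rule nth_equalityI)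
  show "length (subword a i j) = length (subword a i' j')"
    using assms(1) by (simp add: subword_def)
  fix m assume "m < length (subword a i j)"
  then have m: "int m \<le> j - i" "int m \<le> j' - i'"
    using assms(1) by (auto simp: subword_def)
  then show "subword a i j ! m = subword a i' j' ! m"
    using assms(2)[of "i + int m"] by (simp add: subword_def) (simp add: algebra_simps)
qed

text \<open>A stretch from \<open>A\<close> to \<open>A * R\<close> with period
  \<open>q n \<le> A\<close> yields two equal words shifted by \<open>q n\<close>, with
  \<open>s < 2 * A\<close> and \<open>t = A * R - 1\<close>; hence \<open>t / s\<close> is at least
  about \<open>R / 2\<close>, while the shift tends to infinity.\<close>

lemma Dio_admissible_of_periodic_stretches:
  fixes q i :: "nat \<Rightarrow> nat" and \<rho> :: real and R :: nat
  assumes q: "\<And>n. q n > 0" "filterlim q at_top sequentially"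
    and per: "\<And>n m. q n * R ^ i n \<le> m \<Longrightarrow> m + q n < q n * R ^ Suc (i n) \<Longrightarrow> a (m + q n) = a m"
    and R: "real R \<ge> 2 * \<rho> + 1" "R \<ge> 3" and \<rho>: "\<rho> \<ge> 0"
  shows "Dio_admissible a \<rho>"
  unfolding Dio_admissible_def
proof (rule exI[of _ "\<lambda>n. int (q n * R ^ i n) - 1"], rule exI[of _ "\<lambda>n. int (q n * R ^ i n) - 1 + int (q n)"],
    rule exI[of _ "\<lambda>n. int (q n * R ^ i n * R) - 1"], intro conjI allI)
  fix n
  \<comment> \<open>The words start at \<open>r + 1\<close> and \<open>s + 1\<close>, hence the
    offset -1: the first starts at \<open>A\<close>, the second at \<open>A + q n\<close>, and
    \<open>t\<close> is the last position of the stretch.\<close>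
  define A where "A = q n * R ^ i n"
  define r where "r = int A - 1"
  define s where "s = r + int (q n)"
  define t where "t = int (A * R) - 1"
  have qA: "q n \<le> A" "q n > 0"
    using q R by (auto simp: A_def)
  have "A * 3 \<le> A * R"
    using R by simp
  then have "int A * 3 \<le> int (A * R)"
    by linarith
  then show "s < t"
    using qA unfolding s_def t_def r_def by linarith
  show "- 1 \<le> r" "r < s"
    using qA by (auto simp: s_def r_def)
  show "subword a (r + 1) (r + t - s) = subword a (s + 1) t"
  proof (rule subword_eqI)
    fix k assume k: "r + 1 \<le> k" "k \<le> r + t - s"
    define m where "m = nat k"
    have km: "k = int m"
      using k by (simp add: m_def r_def)
    have "A \<le> m" "int m + int (q n) < int (A * R)"
      using k by (auto simp: km r_def s_def t_def)
    then have "m + q n < A * R"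
      by linarith
    with \<open>A \<le> m\<close> have "a (m + q n) = a m"
      using per[of n m] by (simp add: A_def mult_ac)
    moreover have "nat (k + (s + 1 - (r + 1))) = m + q n"
      by (simp add: s_def km)
    ultimately show "a (nat k) = a (nat (k + (s + 1 - (r + 1))))"
      by (simp add: km)
  qed simp
  have "\<rho> * real_of_int s \<le> \<rho> * (2 * real A)"
    using \<rho> qA by (intro mult_left_mono) (auto simp: s_def r_def)
  also have "\<dots> \<le> (real R - 1) * real A"
    using R mult_right_mono[of "2 * \<rho>" "real R - 1" "real A"] by simp
  also have "\<dots> \<le> real_of_int t"
    using qA by (simp add: t_def algebra_simps)
  finally show "\<rho> * real_of_int s \<le> real_of_int t" .
next
  have "filterlim (\<lambda>n. int (q n)) at_top sequentially"
    by (rule filterlim_compose[OF filterlim_int_sequentially q(2)])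
  then show "filterlim (\<lambda>n. int (q n * R ^ i n) - 1 + int (q n) - (int (q n * R ^ i n) - 1)) at_top sequentially"
    by simp
qed

lemma Dio_eq_infinity:
  assumes "\<And>\<rho>. \<rho> \<ge> 0 \<Longrightarrow> Dio_admissible a \<rho>"
  shows "Dio a = \<infinity>"
proof (rule ereal_top)
  fix B :: real
  have "Dio_admissible a (max B 0)"
    using assms by simp
  then have "ereal (max B 0) \<le> Dio a"
    unfolding Dio_def by (intro Sup_upper imageI) simp
  moreover have "ereal B \<le> ereal (max B 0)"
    by simp
  ultimately show "ereal B \<le> Dio a"
    by (rule order_trans[rotated])
qed

section \<open>Size of the approximation errors\<close>

lemma integer_approximation:
  "\<exists>p::int. \<bar>y - of_int p\<bar> = infdist y \<int>"
proof -
  have "\<int> \<noteq> ({}::real set)"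
    using Ints_0 by blast
  then obtain z :: real where "z \<in> \<int>" "infdist y \<int> = dist y z"
    using infdist_attains_inf[of \<int> y] by (auto simp: closed_Ints)
  then show ?thesis
    by (auto simp: dist_real_def elim!: Ints_cases)
qed

text \<open>After taking logarithms, \<open>ln l\<close> and \<open>l * ln q\<close> are each at
  most \<open>l * q\<close>, which gives the 2 in \<open>K\<close>, and
  \<open>Suc (q * m) \<le> q * (m + 1)\<close>. The whole growth is thus linear in \<open>q\<close>
  and is beaten by \<open>N * ln q\<close>.\<close>

lemma small_error:
  fixes q l m R :: nat and N :: real
  assumes q: "q > 0" and R: "R \<ge> 1"
    and K: "real l * (2 + real (m + 1) * ln (real R)) \<le> N * ln (real q) / real q"
  shows "real l * real q powr (- N) * real (q * R ^ Suc (q * m)) ^ l \<le> 1"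
proof (cases "l = 0")
  case False
  have "ln (real l) \<le> real l * real q"
  proof -
    have "ln (real l) \<le> real l"
      using False ln_le_minus_one[of "real l"] by simp
    also have "\<dots> \<le> real l * real q"
      using q by (simp add: mult_le_cancel_left1)
    finally show ?thesis .
  qed
  moreover have "real l * ln (real q) \<le> real l * real q"
    using q ln_le_minus_one[of "real q"] by (intro mult_left_mono) auto
  moreover have "real l * (real (Suc (q * m)) * ln (real R)) \<le> real l * (real (q * (m + 1)) * ln (real R))"
    using q R by (intro mult_left_mono mult_right_mono ln_ge_zero) auto
  moreover have "real l * (2 + real (m + 1) * ln (real R)) * real q \<le> N * ln (real q)"
    using K q by (simp add: field_simps)
  ultimately have le: "ln (real l) - N * ln (real q)
      + real l * (ln (real q) + real (Suc (q * m)) * ln (real R)) \<le> 0"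
    by (simp add: algebra_simps)
  have "real l * real q powr (- N) * real (q * R ^ Suc (q * m)) ^ l
      = exp (ln (real l)) * exp (- N * ln (real q)) * exp (real l * (ln (real q) + real (Suc (q * m)) * ln (real R)))"
  proof -
    have "real (q * R ^ Suc (q * m)) = exp (ln (real q) + real (Suc (q * m)) * ln (real R))"
      using q R by (simp only: exp_add exp_of_nat_mult of_nat_mult of_nat_power) simp
    then show ?thesis
      using False q by (simp only: exp_of_nat_mult) (simp add: powr_def)
  qed
  also have "\<dots> = exp (ln (real l) - N * ln (real q) + real l * (ln (real q) + real (Suc (q * m)) * ln (real R)))"
    by (simp add: exp_add exp_diff exp_minus field_simps)
  also have "\<dots> \<le> 1"
    using le by simp
  finally show ?thesis .
qed simp

theorem theorem8p6:
  fixes l d :: nat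
    and b \<gamma> :: "nat \<Rightarrow> real"
    and g :: "real \<Rightarrow> real"
    and \<Sigma> :: "'a set"
    and c :: "real \<Rightarrow> 'a"
    and a :: "nat \<Rightarrow> 'a"
    and q :: "nat \<Rightarrow> nat"
    and N :: "nat \<Rightarrow> real"
  assumes "l \<ge> 2"
    and "\<And>x. g x = (\<Sum>s=0..l. b s * x ^ s)"
    and "finite \<Sigma>"
    and "c ` {0..<1} \<subseteq> \<Sigma>"
    and "piecewise_constant c \<gamma> d"
    and "\<not> c constant_on {0..<1}"
    and "\<And>n. a n = c (frac (g (real n)))"
    and "\<And>n. q n > 0"
    and "filterlim q at_top sequentially"
    and "\<And>n. 0 < (MAX s\<in>{1..l}. dist_nearest_int (real (q n) * b s))"
    and "\<And>n. (MAX s\<in>{1..l}. dist_nearest_int (real (q n) * b s)) \<le> real (q n) powr (- N n)"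
    and "filterlim (\<lambda>n. N n * ln (real (q n)) / real (q n)) at_top sequentially"
  shows "Dio a = \<infinity>"
proof (rule Dio_eq_infinity)
  fix \<rho> :: real assume \<rho>: "\<rho> \<ge> 0"
  \<comment> \<open>One choice secures both \<open>R \<ge> 3\<close> and
    \<open>R \<ge> 2 * \<rho> + 1\<close>.\<close>
  obtain R :: nat where R: "real R \<ge> 2 * \<rho> + 3"
    using real_arch_simple by blast
  then have R3: "R \<ge> 3"
    using \<rho> by linarith
  \<comment> \<open>Changes per unit of \<open>q\<close>. Neither \<open>m\<close> nor
    \<open>R\<close> depends on \<open>n\<close>, so the growth hypothesis eventually exceeds the
    constant built from them.\<close>
  define m where "m = 3 * Suc d * l"
  have "eventually (\<lambda>n. real l * (2 + real (m + 1) * ln (real R)) \<le> N n * ln (real (q n)) / real (q n)) sequentially"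
    using assms(12) by (simp add: filterlim_at_top)
  then obtain n0 where n0: "\<And>n. n \<ge> n0 \<Longrightarrow>
      real l * (2 + real (m + 1) * ln (real R)) \<le> N n * ln (real (q n)) / real (q n)"
    by (auto simp: eventually_sequentially)
  have "\<exists>i. \<forall>k. q n * R ^ i \<le> k \<longrightarrow> k + q n < q n * R ^ Suc i \<longrightarrow> a (k + q n) = a k" if "n \<ge> n0" for n
  proof -
    have "\<forall>s. \<exists>k::int. \<bar>real (q n) * b s - of_int k\<bar> = dist_nearest_int (real (q n) * b s)"
      using integer_approximation by blast
    then obtain p where p: "\<And>s. \<bar>real (q n) * b s - of_int (p s)\<bar> = dist_nearest_int (real (q n) * b s)"
      by metis
    show ?thesis
    proof (rule periodic_stretch[OF assms(2,5,7,8)])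
      show "R \<ge> 1"
        using R3 by simp
      show "real (q n) * b s = of_int (p s) + (real (q n) * b s - of_int (p s))" for s
        by simp
      show "\<bar>real (q n) * b s - of_int (p s)\<bar> \<le> real (q n) powr (- N n)" if "s \<in> {1..l}" for s
        unfolding p using that by (intro order_trans[OF Max_ge assms(11)]) auto
      show "q n * (3 * Suc d) * l \<le> q n * m"
        by (simp add: m_def)
      show "real l * real (q n) powr (- N n) * real (q n * R ^ Suc (q n * m)) ^ l \<le> 1"
        using R3 n0[OF that] by (intro small_error assms(8)) auto
    qed
  qed
  then obtain i where i: "\<And>n k. n \<ge> n0 \<Longrightarrow> q n * R ^ i n \<le> k \<Longrightarrow> k + q n < q n * R ^ Suc (i n) \<Longrightarrow> a (k + q n) = a k"
    by metis
  \<comment> \<open>Admissibility asks for words at every index, but the stretches exist only from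
    \<open>n0\<close> on; hence the shift.\<close>
  have "filterlim (\<lambda>n. q (n + n0)) at_top sequentially"
    using assms(9) by (rule filterlim_compose) (rule filterlim_add_const_nat_at_top)
  then show "Dio_admissible a \<rho>"
    using R R3 \<rho> assms(8)
    by (intro Dio_admissible_of_periodic_stretches[of "\<lambda>n. q (n + n0)" R "\<lambda>n. i (n + n0)"] i) auto
qed

end
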